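(* Let $f:\mathbb{R}^n\to\mathbb{R}$ be a Kolmogorov-Arnold network (KAN) with $L\ge 1$ layers, structure $[n_0,n_1,\dots,n_L]$ with $n_0=n$ and $n_L=1$, whose spline functions $\varphi_{l,j,i}$ are linearly extended cubic Hermite splines with $K\ge 2$ knots on a common interval $I=[x^1,x^K]$, with spline weights $\omega^{\varphi}_{l,j,i}$, base weights $\omega^{\mathbf b}_{l,j,i}$, biases $\theta_{l,j}$ and base activation function $\mathbf b:\mathbb{R}\to\mathbb{R}$ (all as defined in the context). Let $1\le r\le n$ and assume that $\mathbf b$ is monotonically increasing (i.e. non-decreasing). Suppose that the following conditions hold. Input layer, for all $1\le j\le n_1$ and all $1\le k\le K-1$: 1. $\omega^{\varphi}_{0,j,r}\ge 0$ and $\omega^{\mathbf b}_{0,j,r}\ge 0$ (resp. $\omega^{\varphi}_{0,j,r}\ge 0$ and $\omega^{\mathbf b}_{0,j,r}\le 0$); 2. $y^{k+1}_{0,j,r}\ge y^{k}_{0,j,r}$, i.e. $d^k_{0,j,r}\ge 0$ (resp. $y^{k+1}_{0,j,r}\le y^{k}_{0,j,r}$, i.e. $d^k_{0,j,r}\le 0$); 3. if $d^k_{0,j,r}=0$, then $m^k_{0,j,r}=m^{k+1}_{0,j,r}=0$; 4. if $d^k_{0,j,r}>0$, then $m^k_{0,j,r}\ge 0$ and $m^{k+1}_{0,j,r}\ge 0$ (resp. if $d^k_{0,j,r}<0$, then $m^k_{0,j,r}\le 0$ and $m^{k+1}_{0,j,r}\le 0$); 5. if $d^k_{0,j,r}>0$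 (resp. if $d^k_{0,j,r}<0$), then $(\alpha^k_{0,j,r})^2+(\beta^k_{0,j,r})^2\le 9$. Hidden layers (in both the increasing and the decreasing case), for all $1\le l\le L-1$, $1\le i\le n_l$, $1\le j\le n_{l+1}$ and $1\le k\le K-1$: 6. $\omega^{\varphi}_{l,j,i}\ge 0$ and $\omega^{\mathbf b}_{l,j,i}\ge 0$; 7. $y^{k+1}_{l,j,i}\ge y^k_{l,j,i}$; 8. if $d^k_{l,j,i}=0$, then $m^k_{l,j,i}=m^{k+1}_{l,j,i}=0$; 9. if $d^k_{l,j,i}>0$, then $m^k_{l,j,i}\ge 0$ and $m^{k+1}_{l,j,i}\ge 0$; 10. if $d^k_{l,j,i}>0$, then $(\alpha^k_{l,j,i})^2+(\beta^k_{l,j,i})^2\le 9$. Then $f$ is increasingly (resp. decreasingly) partially monotonic with respect to its $r$-th input on all of $\mathbb{R}^n$.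
   Context: Partial monotonicity: a function $f:\mathbb{R}^n\to\mathbb{R}$ is increasingly (resp. decreasingly) partially monotonic with respect to its $r$-th input if for all $x_1,\dots,x_n,x_r'\in\mathbb{R}$ with $x_r\le x_r'$ one has $f(x_1,\dots,x_r,\dots,x_n)\le f(x_1,\dots,x_r',\dots,x_n)$ (resp. $\ge$). All monotonicity is in the weak (non-strict) sense. KAN: a KAN with $L$ layers and structure $[n_0,\dots,n_L]$ maps an input $\mathbf{x}_0=(x_{0,1},\dots,x_{0,n_0})\in\mathbb{R}^{n_0}$ to the output $\mathbf{x}_L$ computed recursively, for $0\le l\le L-1$ and $1\le j\le n_{l+1}$, by $$x_{l+1,j}=\sum_{i=1}^{n_l}\Big(\omega^{\varphi}_{l,j,i}\,\varphi_{l,j,i}(x_{l,i})+\omega^{\mathbf b}_{l,j,i}\,\mathbf b(x_{l,i})\Big)+\theta_{l,j},$$ where $\omega^{\varphi}_{l,j,i},\omega^{\mathbf b}_{l,j,i},\theta_{l,j}\in\mathbb{R}$ are parameters, $\mathbf b:\mathbb{R}\to\mathbb{R}$ is a fixed base activation function, and $\varphi_{l,j,i}:\mathbb{R}\to\mathbb{R}$ is a spline. When $n_L=1$ the KAN is the function $f(\mathbf{x}_0)=x_{L,1}$. Splines: each $\varphi_{l,j,i}$ is determined by data $(x^k_{l,j,i},y^k_{l,j,i},m^k_{l,j,i})$, $1\le k\le K$, with knots $x^1=x^1_{l,j,i}<x^2_{l,j,i}<\dots<x^K_{l,j,i}=x^K$. On $[x^1,x^K]$ it is the cubic Hermite spline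 of this data: on each subinterval $[x^k_{l,j,i},x^{k+1}_{l,j,i}]$ it is the unique polynomial $p$ of degree at most $3$ with $p(x^k_{l,j,i})=y^k_{l,j,i}$, $p'(x^k_{l,j,i})=m^k_{l,j,i}$, $p(x^{k+1}_{l,j,i})=y^{k+1}_{l,j,i}$, $p'(x^{k+1}_{l,j,i})=m^{k+1}_{l,j,i}$. Outside $[x^1,x^K]$ it is extended linearly (and continuously), with slope $m^1_{l,j,i}$ to the left of $x^1$ and slope $m^K_{l,j,i}$ to the right of $x^K$. Notation, for $1\le k\le K-1$: $$d^k_{l,j,i}=\frac{y^{k+1}_{l,j,i}-y^k_{l,j,i}}{x^{k+1}_{l,j,i}-x^k_{l,j,i}},$$ and, when $d^k_{l,j,i}\ne 0$, $\alpha^k_{l,j,i}=m^k_{l,j,i}/d^k_{l,j,i}$ and $\beta^k_{l,j,i}=m^{k+1}_{l,j,i}/d^k_{l,j,i}$. *)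

theory Defs
  imports Complex_Main "HOL-Library.FuncSet" "HOL-Computational_Algebra.Polynomial"
begin

(* All indices start at 1, except the layer index l, which starts at 0.  A point of R^n is a
   function in {1..n} \<rightarrow>\<^sub>E UNIV, so its coordinates are x 1, ..., x n. *)

definition partially_increasing :: "nat \<Rightarrow> nat \<Rightarrow> ((nat \<Rightarrow> real) \<Rightarrow> real) \<Rightarrow> bool" where
  "partially_increasing n r f \<longleftrightarrow>
     (\<forall>x \<in> {1..n} \<rightarrow>\<^sub>E UNIV. \<forall>t. x r \<le> t \<longrightarrow> f x \<le> f (x(r := t)))"

definition partially_decreasing :: "nat \<Rightarrow> nat \<Rightarrow> ((nat \<Rightarrow> real) \<Rightarrow> real) \<Rightarrow> bool" where
  "partially_decreasing n r f \<longleftrightarrow>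
     (\<forall>x \<in> {1..n} \<rightarrow>\<^sub>E UNIV. \<forall>t. x r \<le> t \<longrightarrow> f (x(r := t)) \<le> f x)"

definition is_hermite_cubic ::
  "real \<Rightarrow> real \<Rightarrow> real \<Rightarrow> real \<Rightarrow> real \<Rightarrow> real \<Rightarrow> real poly \<Rightarrow> bool" where
  "is_hermite_cubic a b ya yb ma mb p \<longleftrightarrow> degree p \<le> 3 \<and>
     poly p a = ya \<and> poly (pderiv p) a = ma \<and> poly p b = yb \<and> poly (pderiv p) b = mb"

definition hermite_cubic ::
  "real \<Rightarrow> real \<Rightarrow> real \<Rightarrow> real \<Rightarrow> real \<Rightarrow> real \<Rightarrow> real poly" where
  "hermite_cubic a b ya yb ma mb = (THE p. is_hermite_cubic a b ya yb ma mb p)"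

(* A knot interior to the interval belongs to two pieces; LEAST picks the left one.  The two
   pieces agree there, see hermite_spline_piece below. *)
definition hermite_spline ::
  "nat \<Rightarrow> (nat \<Rightarrow> real) \<Rightarrow> (nat \<Rightarrow> real) \<Rightarrow> (nat \<Rightarrow> real) \<Rightarrow> real \<Rightarrow> real" where
  "hermite_spline K x y m t =
     (if t < x 1 then y 1 + m 1 * (t - x 1)
      else if x K < t then y K + m K * (t - x K)
      else let k = (LEAST k. 1 \<le> k \<and> k < K \<and> x k \<le> t \<and> t \<le> x (k + 1))
           in poly (hermite_cubic (x k) (x (k + 1)) (y k) (y (k + 1)) (m k) (m (k + 1))) t)"

(* Edge-indexed fields take their arguments in the order l, j, i (edge from node i of layer l
   to node j of layer l + 1); the spline data take the knot index k last. *)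
record kan =
  depth :: nat
  width :: "nat \<Rightarrow> nat"
  num_knots :: nat
  knot :: "nat \<Rightarrow> nat \<Rightarrow> nat \<Rightarrow> nat \<Rightarrow> real"
  val :: "nat \<Rightarrow> nat \<Rightarrow> nat \<Rightarrow> nat \<Rightarrow> real"
  slope :: "nat \<Rightarrow> nat \<Rightarrow> nat \<Rightarrow> nat \<Rightarrow> real"
  spline_weight :: "nat \<Rightarrow> nat \<Rightarrow> nat \<Rightarrow> real"
  base_weight :: "nat \<Rightarrow> nat \<Rightarrow> nat \<Rightarrow> real"
  bias :: "nat \<Rightarrow> nat \<Rightarrow> real"
  base :: "real \<Rightarrow> real"

(* Only the endpoints of the knot sequences are common to all edges, not the interior knots. *)
definition kan_wf :: "kan \<Rightarrow> bool" where
  "kan_wf N \<longleftrightarrow> 1 \<le> depth N \<and> 2 \<le> num_knots N \<and>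
     (\<exists>a b. \<forall>l < depth N. \<forall>j \<in> {1..width N (l + 1)}. \<forall>i \<in> {1..width N l}.
        strict_mono_on {1..num_knots N} (knot N l j i) \<and>
        knot N l j i 1 = a \<and> knot N l j i (num_knots N) = b)"

definition spline :: "kan \<Rightarrow> nat \<Rightarrow> nat \<Rightarrow> nat \<Rightarrow> real \<Rightarrow> real" where
  "spline N l j i = hermite_spline (num_knots N) (knot N l j i) (val N l j i) (slope N l j i)"

primrec layer :: "kan \<Rightarrow> nat \<Rightarrow> (nat \<Rightarrow> real) \<Rightarrow> nat \<Rightarrow> real" where
  "layer N 0 x = x"
| "layer N (Suc l) x = (\<lambda>j.
     (\<Sum>i = 1..width N l. spline_weight N l j i * spline N l j i (layer N l x i) +
                          base_weight N l j i * base N (layer N l x i)) + bias N l j)"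

definition kan_fun :: "kan \<Rightarrow> (nat \<Rightarrow> real) \<Rightarrow> real" where
  "kan_fun N x = layer N (depth N) x 1"

definition secant :: "kan \<Rightarrow> nat \<Rightarrow> nat \<Rightarrow> nat \<Rightarrow> nat \<Rightarrow> real" where
  "secant N l j i k =
     (val N l j i (k + 1) - val N l j i k) / (knot N l j i (k + 1) - knot N l j i k)"

definition alpha :: "kan \<Rightarrow> nat \<Rightarrow> nat \<Rightarrow> nat \<Rightarrow> nat \<Rightarrow> real" where
  "alpha N l j i k = slope N l j i k / secant N l j i k"

definition beta :: "kan \<Rightarrow> nat \<Rightarrow> nat \<Rightarrow> nat \<Rightarrow> nat \<Rightarrow> real" where
  "beta N l j i k = slope N l j i (k + 1) / secant N l j i k"

lemma hermite_cubic_ex1: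
  assumes "a < b"
  shows "\<exists>!p. is_hermite_cubic a b ya yb ma mb p"
proof -
  define h where "h = b - a"
  have h: "h \<noteq> 0" using assms by (simp add: h_def)
  define c where "c = (3 * (yb - ya) / h - 2 * ma - mb) / h"
  define d where "d = (ma + mb - 2 * (yb - ya) / h) / h\<^sup>2"
  define X where "X = [:- a, 1:]"
  define p where "p = [:ya:] + smult ma X + smult c (X ^ 2) + smult d (X ^ 3)"
  have dX: "degree (X ^ k) = k" for k
    by (simp add: X_def degree_linear_power)
  have "degree p \<le> 3"
    unfolding p_def by (intro degree_add_le order.trans[OF degree_smult_le]) (simp_all add: dX, simp add: X_def)
  moreover have ev: "poly p t = ya + ma * (t - a) + c * (t - a)\<^sup>2 + d * (t - a) ^ 3" for t
    by (simp add: p_def X_def right_diff_distrib mult.commute)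
  moreover have ev': "poly (pderiv p) t = ma + 2 * c * (t - a) + 3 * d * (t - a)\<^sup>2" for t
    by (simp add: p_def X_def pderiv_add pderiv_smult pderiv_mult pderiv_pCons power2_eq_square
        power3_eq_cube algebra_simps)
  moreover have "poly p b = yb"
    using h by (simp add: ev flip: h_def)
      (simp add: c_def d_def field_simps power2_eq_square power3_eq_cube)
  moreover have "poly (pderiv p) b = mb"
    using h by (simp add: ev' flip: h_def)
      (simp add: c_def d_def field_simps power2_eq_square power3_eq_cube)
  ultimately have ex: "is_hermite_cubic a b ya yb ma mb p"
    by (simp add: is_hermite_cubic_def)
  have "q = p" if q: "is_hermite_cubic a b ya yb ma mb q" for q
  proof (rule ccontr)
    assume "q \<noteq> p"
    define s where "s = q - p"
    have s0: "s \<noteq> 0" using \<open>q \<noteq> p\<close> by (simp add: s_def)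
    have ds: "degree s \<le> 3"
      using q ex unfolding s_def is_hermite_cubic_def by (simp add: degree_diff_le)
    have sz: "poly s a = 0" "poly (pderiv s) a = 0" "poly s b = 0" "poly (pderiv s) b = 0"
      using q ex by (simp_all add: s_def is_hermite_cubic_def pderiv_diff)
    have pd: "poly (pderiv ([:- e, 1:] * u)) t = poly u t + (t - e) * poly (pderiv u) t" for e t :: real and u
      by (simp only: pderiv_mult) (simp add: pderiv_pCons algebra_simps)
    obtain u where u: "s = X * u"
      using sz(1) unfolding X_def poly_eq_0_iff_dvd by (auto elim: dvdE)
    have "poly u a = 0"
      using sz(2) unfolding u X_def pd by simp
    then obtain v where v: "u = X * v"
      unfolding X_def poly_eq_0_iff_dvd by (auto elim: dvdE)
    have vb: "poly v b = 0"
      using sz(3) assms unfolding u v X_def by (simp only: poly_mult) simp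
    then have "poly (pderiv v) b = 0"
      using sz(4) assms unfolding u v X_def pd by (simp only: pd poly_mult) simp
    moreover obtain w where w: "v = [:- b, 1:] * w"
      using vb unfolding poly_eq_0_iff_dvd by (auto elim: dvdE)
    ultimately have "poly w b = 0"
      unfolding w pd by simp
    then obtain z where z: "w = [:- b, 1:] * z"
      unfolding poly_eq_0_iff_dvd by (auto elim: dvdE)
    have sf: "s = (X * X * [:- b, 1:] * [:- b, 1:]) * z"
      by (simp only: u v w z ac_simps)
    with s0 have "z \<noteq> 0" by auto
    then have "degree s = degree (X * X * [:- b, 1:] * [:- b, 1:]) + degree z"
      unfolding sf by (intro degree_mult_eq) (simp_all add: X_def)
    also have "degree (X * X * [:- b, 1:] * [:- b, 1:]) = 4"
      by (simp add: X_def)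
    finally show False using ds by simp
  qed
  with ex show ?thesis by blast
qed

lemma hermite_cubic:
  assumes "a < b"
  shows "is_hermite_cubic a b ya yb ma mb (hermite_cubic a b ya yb ma mb)"
  unfolding hermite_cubic_def using hermite_cubic_ex1[OF assms] by (rule theI')

lemma hermite_spline_piece:
  assumes mono: "strict_mono_on {1..K} x" and k: "1 \<le> k" "k < K" and t: "x k \<le> t" "t \<le> x (k + 1)"
  shows "hermite_spline K x y m t =
           poly (hermite_cubic (x k) (x (k + 1)) (y k) (y (k + 1)) (m k) (m (k + 1))) t"
proof -
  have less: "x i < x j" if "1 \<le> i" "i < j" "j \<le> K" for i j
    using strict_mono_onD[OF mono, of i j] that by simp
  have le: "x i \<le> x j" if "1 \<le> i" "i \<le> j" "j \<le> K" for i j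
    using less[of i j] that by (cases "i = j") auto
  define P where "P i \<longleftrightarrow> 1 \<le> i \<and> i < K \<and> x i \<le> t \<and> t \<le> x (i + 1)" for i
  define j where "j = (LEAST i. P i)"
  have "P k" using k t by (simp add: P_def)
  then have Pj: "P j" and jk: "j \<le> k"
    unfolding j_def by (rule LeastI, intro Least_le)
  have "\<not> t < x 1" "\<not> x K < t"
    using le[of 1 k] le[of "k + 1" K] k t by auto
  then have *: "hermite_spline K x y m t =
           poly (hermite_cubic (x j) (x (j + 1)) (y j) (y (j + 1)) (m j) (m (j + 1))) t"
    by (simp add: hermite_spline_def j_def P_def Let_def)
  show ?thesis
  proof (cases "j = k")
    case False
    with jk have "x (j + 1) \<le> x k" using k by (intro le) auto
    with Pj t have tt: "t = x (j + 1)" "t = x k" by (auto simp: P_def)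
    have "j + 1 = k"
      using less[of "j + 1" k] tt False jk k by (cases "j + 1 < k") auto
    moreover have "x j < x (j + 1)" "x k < x (k + 1)"
      using k jk Pj by (auto intro!: less simp: P_def)
    ultimately show ?thesis
      unfolding * using hermite_cubic[of "x j" "x (j + 1)"] hermite_cubic[of "x k" "x (k + 1)"] tt
      by (simp add: is_hermite_cubic_def)
  qed (use * in simp)
qed

end

(* Fritsch and Carlson: with u = t - a, v = b - t, h = b - a, the derivative of a Hermite cubic
   with secant slope d on [a,b] is d / h^2 times the quadratic form
   6uv + alpha v(v - 2u) + beta u(u - 2v), which is nonnegative for u, v >= 0 as soon as (alpha, beta)
   lies in the closed first quadrant of the disc of radius 3.  So every spline is monotone with the
   sign of its secants, and monotonicity is propagated through the layers by nonnegative weights. *)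
theory Submission
  imports Defs
begin

section \<open>Nonnegativity of the Fritsch-Carlson quadratic form\<close>

text \<open>If one variable is at least twice the other, only one of the two coefficient terms can
  be negative, and a coefficient at most 3 keeps it within \<open>6 * u * v\<close>. In the
  remaining cone both terms can be negative, and Cauchy-Schwarz bounds them jointly by the radius 3
  times the length of \<open>(p, q)\<close>.\<close>

lemma fritsch_carlson_form_nonneg:
  fixes \<alpha> \<beta> u v :: real
  assumes "0 \<le> \<alpha>" "0 \<le> \<beta>" "\<alpha>\<^sup>2 + \<beta>\<^sup>2 \<le> 9" "0 \<le> u" "0 \<le> v"
  shows "0 \<le> 6 * u * v + \<alpha> * (v * (v - 2 * u)) + \<beta> * (u * (u - 2 * v))"
proof -
  have "\<alpha>\<^sup>2 \<le> 3\<^sup>2" "\<beta>\<^sup>2 \<le> 3\<^sup>2"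
    by (rule order.trans[OF _ assms(3), THEN order.trans]; simp)+
  then have le3: "\<alpha> \<le> 3" "\<beta> \<le> 3"
    by (auto intro: power2_le_imp_le)
  consider "2 * u \<le> v" | "2 * v \<le> u" | "v \<le> 2 * u" "u \<le> 2 * v" by linarith
  then show ?thesis
  proof cases
    case 1
    have "\<beta> * (u * (2 * v - u)) \<le> 3 * (u * (2 * v - u))"
      using 1 assms le3 by (intro mult_right_mono) auto
    moreover have "0 \<le> \<alpha> * (v * (v - 2 * u))" using 1 assms by auto
    moreover have "3 * (u * (2 * v - u)) \<le> 6 * u * v" by (simp add: algebra_simps)
    moreover have "\<beta> * (u * (u - 2 * v)) = - (\<beta> * (u * (2 * v - u)))" by (simp add: algebra_simps)
    ultimately show ?thesis by linarith
  next
    case 2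
    have "\<alpha> * (v * (2 * u - v)) \<le> 3 * (v * (2 * u - v))"
      using 2 assms le3 by (intro mult_right_mono) auto
    moreover have "0 \<le> \<beta> * (u * (u - 2 * v))" using 2 assms by auto
    moreover have "3 * (v * (2 * u - v)) \<le> 6 * u * v" by (simp add: algebra_simps)
    moreover have "\<alpha> * (v * (v - 2 * u)) = - (\<alpha> * (v * (2 * u - v)))" by (simp add: algebra_simps)
    ultimately show ?thesis by linarith
  next
    case 3
    define p where "p = v * (2 * u - v)"
    define q where "q = u * (2 * v - u)"
    have pq: "p\<^sup>2 + q\<^sup>2 \<le> (2 * u * v)\<^sup>2"
    proof -
      \<comment> \<open>In this cone both factors of \<open>w\<close> are nonnegative; four times
        the gap in \<open>pq\<close> is then a sum of nonnegative terms in \<open>w\<close>,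
        \<open>u * v\<close> and \<open>u - v\<close>.\<close>
      define w where "w = (2 * u - v) * (2 * v - u)"
      have "0 \<le> w" using 3 by (simp add: w_def)
      then have "0 \<le> w * (2 * (u - v)\<^sup>2) + u * v * w + 7 * (u * v)\<^sup>2"
        using assms by simp
      also have "\<dots> = 4 * ((2 * u * v)\<^sup>2 - (p\<^sup>2 + q\<^sup>2))"
        by (simp add: p_def q_def w_def power2_eq_square algebra_simps)
      finally show ?thesis by simp
    qed
    \<comment> \<open>Lagrange's identity: dropping the second square gives Cauchy-Schwarz without
      square roots.\<close>
    have "(\<alpha> * p + \<beta> * q)\<^sup>2 + (\<alpha> * q - \<beta> * p)\<^sup>2 = (\<alpha>\<^sup>2 + \<beta>\<^sup>2) * (p\<^sup>2 + q\<^sup>2)"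
      by (simp add: power2_eq_square algebra_simps)
    also have "\<dots> \<le> 9 * (2 * u * v)\<^sup>2"
      using assms pq by (intro mult_mono) auto
    also have "\<dots> = (6 * u * v)\<^sup>2"
      by (simp add: power_mult_distrib)
    finally have "(\<alpha> * p + \<beta> * q)\<^sup>2 \<le> (6 * u * v)\<^sup>2"
      by (rule order.trans[rotated]) simp
    then have "\<alpha> * p + \<beta> * q \<le> 6 * u * v"
      by (rule power2_le_imp_le) (use assms in simp)
    then show ?thesis by (simp add: p_def q_def algebra_simps)
  qed
qed

section \<open>Monotonicity of a single Hermite cubic\<close>

text \<open>Once the end values and end slopes are written through the four coefficients of
  \<open>p\<close>, this is a polynomial identity; the factor \<open>(b - a) ^ 3\<close> clears the
  denominators.\<close>

lemma hermite_cubic_pderiv: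
  assumes "is_hermite_cubic a b ya yb ma mb p"
  shows "(b - a) ^ 3 * poly (pderiv p) t =
           6 * (yb - ya) * (t - a) * (b - t) +
           (b - a) * (ma * ((b - t) * ((b - t) - 2 * (t - a))) + mb * ((t - a) * ((t - a) - 2 * (b - t))))"
proof -
  define c where "c = coeff p"
  have deg: "degree p \<le> 3" using assms by (simp add: is_hermite_cubic_def)
  have p: "p = [:c 0, c 1, c 2, c 3:]"
  proof (rule poly_eqI)
    fix n
    show "coeff p n = coeff [:c 0, c 1, c 2, c 3:] n"
      using deg by (auto simp: c_def coeff_pCons numeral_2_eq_2 numeral_3_eq_3 coeff_eq_0 split: nat.split)
  qed
  have ev: "poly p s = c 0 + c 1 * s + c 2 * s\<^sup>2 + c 3 * s ^ 3" for s
    unfolding p by (simp add: power2_eq_square power3_eq_cube algebra_simps)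
  have ev': "poly (pderiv p) s = c 1 + 2 * c 2 * s + 3 * c 3 * s\<^sup>2" for s
    unfolding p by (simp add: pderiv_pCons power2_eq_square algebra_simps)
  have y: "ya = poly p a" "yb = poly p b" "ma = poly (pderiv p) a" "mb = poly (pderiv p) b"
    using assms by (simp_all add: is_hermite_cubic_def)
  show ?thesis
    unfolding y ev ev' by (simp add: power2_eq_square power3_eq_cube algebra_simps)
qed

text \<open>Phrased through the ratios of slopes to secant, which do not change when the data are
  negated, so that one predicate serves increasing and decreasing pieces.\<close>

definition fritsch_carlson :: "real \<Rightarrow> real \<Rightarrow> real \<Rightarrow> bool" where
  "fritsch_carlson d m m' \<longleftrightarrow> (d = 0 \<longrightarrow> m = 0 \<and> m' = 0) \<and>
     (d \<noteq> 0 \<longrightarrow> 0 \<le> m / d \<and> 0 \<le> m' / d \<and> (m / d)\<^sup>2 + (m' / d)\<^sup>2 \<le> 9)"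

(* The sign c = 1 or c = -1 treats increasing and decreasing splines at once. *)
lemma hermite_cubic_mono:
  assumes "a < b" and "0 \<le> c * (yb - ya)" and "fritsch_carlson ((yb - ya) / (b - a)) ma mb"
  shows "mono_on {a..b} (\<lambda>t. c * poly (hermite_cubic a b ya yb ma mb) t)"
proof (rule mono_onI)
  fix s t assume st: "s \<in> {a..b}" "t \<in> {a..b}" "s \<le> t"
  define p where "p = hermite_cubic a b ya yb ma mb"
  define h where "h = b - a"
  define d where "d = (yb - ya) / h"
  define \<alpha> where "\<alpha> = ma / d"
  define \<beta> where "\<beta> = mb / d"
  have h: "0 < h" using assms(1) by (simp add: h_def)
  have fc: "fritsch_carlson d ma mb" using assms(3) by (simp add: d_def h_def)
  \<comment> \<open>These also hold for \<open>d = 0\<close>: the slopes vanish by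
    \<open>fc\<close>, and division by zero makes \<alpha> and \<beta> zero. Flat pieces thus need
    no separate treatment below.\<close>
  have eqs: "yb - ya = d * h" "ma = \<alpha> * d" "mb = \<beta> * d"
    using h fc by (auto simp: d_def \<alpha>_def \<beta>_def fritsch_carlson_def)
  have \<alpha>\<beta>: "0 \<le> \<alpha>" "0 \<le> \<beta>" "\<alpha>\<^sup>2 + \<beta>\<^sup>2 \<le> 9"
    using fc by (cases "d = 0"; simp add: \<alpha>_def \<beta>_def fritsch_carlson_def)+
  have "0 \<le> c * d * h" using assms(2) by (simp add: eqs(1) mult.assoc)
  then have cd: "0 \<le> c * d" using h by (simp add: zero_le_mult_iff)
  have deriv: "0 \<le> c * poly (pderiv p) z" if z: "a \<le> z" "z \<le> b" for z
  proof -
    define Q where "Q = 6 * (z - a) * (b - z) + \<alpha> * ((b - z) * ((b - z) - 2 * (z - a)))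
      + \<beta> * ((z - a) * ((z - a) - 2 * (b - z)))"
    have "h ^ 3 * poly (pderiv p) z = h * (d * Q)"
      using hermite_cubic_pderiv[OF hermite_cubic[OF assms(1)], of ya yb ma mb z]
      unfolding p_def[symmetric] unfolding h_def[symmetric] eqs Q_def by (simp add: algebra_simps)
    \<comment> \<open>One factor \<open>h\<close> cancels; what remains is the product of the
      nonnegative \<open>c * d\<close> with the quadratic form.\<close>
    then have "h\<^sup>2 * (c * poly (pderiv p) z) = c * d * Q"
      using h by (simp add: power3_eq_cube power2_eq_square)
    moreover have "0 \<le> Q"
      unfolding Q_def using \<alpha>\<beta> z by (intro fritsch_carlson_form_nonneg) auto
    ultimately have "0 \<le> h\<^sup>2 * (c * poly (pderiv p) z)"
      using cd by (metis mult_nonneg_nonneg)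
    then show ?thesis
      using h by (simp add: zero_le_mult_iff)
  qed
  have "c * poly p s \<le> c * poly p t"
  proof (rule DERIV_nonneg_imp_nondecreasing[OF st(3)])
    fix z assume "s \<le> z" "z \<le> t"
    then show "\<exists>y. ((\<lambda>t. c * poly p t) has_real_derivative y) (at z) \<and> 0 \<le> y"
      using st deriv[of z] by (intro exI[of _ "c * poly (pderiv p) z"]) (auto intro!: DERIV_cmult poly_DERIV)
  qed
  then show "c * poly (hermite_cubic a b ya yb ma mb) s \<le> c * poly (hermite_cubic a b ya yb ma mb) t"
    by (simp add: p_def)
qed

section \<open>From cubic pieces to the extended spline\<close>

text \<open>A comparison across the two sets passes through the common point \<open>b\<close>; the
  reverse crossing forces both points to be \<open>b\<close>.\<close>

lemma mono_on_Un_linked: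
  fixes f :: "'a::linorder \<Rightarrow> 'b::order"
  assumes "mono_on A f" "mono_on B f" "b \<in> A" "b \<in> B" "A \<subseteq> {..b}" "B \<subseteq> {b..}"
  shows "mono_on (A \<union> B) f"
proof (rule mono_onI)
  fix s t assume st: "s \<in> A \<union> B" "t \<in> A \<union> B" "s \<le> t"
  consider "s \<in> A" "t \<in> A" | "s \<in> B" "t \<in> B" | "s \<in> A" "t \<in> B" | "s \<in> B" "t \<in> A"
    using st by blast
  then show "f s \<le> f t"
  proof cases
    case 3
    then have "f s \<le> f b" "f b \<le> f t"
      using assms by (auto intro: mono_onD)
    then show ?thesis by (rule order.trans)
  next
    case 4
    then have "s = t" using assms(5,6) st(3) by force
    then show ?thesis by simp
  qed (use assms st(3) in \<open>auto intro: mono_onD\<close>)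
qed

text \<open>The left tail, the cubic pieces and the right tail are each monotone up to the sign
  \<open>c\<close>, and consecutive ones share a knot at which they are glued.\<close>

lemma hermite_spline_mono:
  assumes K: "2 \<le> K" and x: "strict_mono_on {1..K} x"
    and y: "\<And>k. k \<in> {1..K - 1} \<Longrightarrow> 0 \<le> c * (y (k + 1) - y k)"
    and fc: "\<And>k. k \<in> {1..K - 1} \<Longrightarrow>
      fritsch_carlson ((y (k + 1) - y k) / (x (k + 1) - x k)) (m k) (m (k + 1))"
  shows "mono (\<lambda>t. c * hermite_spline K x y m t)"
proof -
  let ?f = "\<lambda>t. c * hermite_spline K x y m t"
  have less: "x k < x (k + 1)" if "k \<in> {1..K - 1}" for k
    using strict_mono_onD[OF x, of k "k + 1"] that by auto
  have le: "x 1 \<le> x K"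
    using strict_mono_onD[OF x, of 1 K] K by simp
  \<comment> \<open>The tails are linear with slopes \<open>m 1\<close> and \<open>m K\<close>, so
    these must carry the sign of the secants; this follows by writing a slope as \<open>d\<close>
    times its nonnegative ratio to \<open>d\<close>.\<close>
  have slope: "0 \<le> c * m k" "0 \<le> c * m (k + 1)" if k: "k \<in> {1..K - 1}" for k
  proof -
    define d where "d = (y (k + 1) - y k) / (x (k + 1) - x k)"
    have "c * d = c * (y (k + 1) - y k) / (x (k + 1) - x k)" by (simp add: d_def)
    with y[OF k] less[OF k] have cd: "0 \<le> c * d" by simp
    have fcd: "fritsch_carlson d (m k) (m (k + 1))" using fc[OF k] by (simp add: d_def)
    have "0 \<le> c * m k \<and> 0 \<le> c * m (k + 1)"
    proof (cases "d = 0")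
      case False
      then have "c * m k = (c * d) * (m k / d)" "c * m (k + 1) = (c * d) * (m (k + 1) / d)" by simp_all
      then show ?thesis
        using fcd cd False unfolding fritsch_carlson_def by (metis mult_nonneg_nonneg)
    qed (use fcd in \<open>simp add: fritsch_carlson_def\<close>)
    then show "0 \<le> c * m k" "0 \<le> c * m (k + 1)" by auto
  qed
  \<comment> \<open>At the two outer knots \<open>hermite_spline\<close> takes its cubic branch;
    these values extend the linear formulas to the closed half-lines, as the gluing
    requires.\<close>
  have ends: "hermite_spline K x y m (x 1) = y 1" "hermite_spline K x y m (x K) = y K"
  proof -
    have k: "1 \<in> {1..K - 1}" "K - 1 \<in> {1..K - 1}" "K - 1 + 1 = K" using K by auto
    note lt = less[OF k(1)] less[OF k(2), unfolded k(3)]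
    show "hermite_spline K x y m (x 1) = y 1"
      using hermite_cubic[OF lt(1)] hermite_spline_piece[OF x, of 1 "x 1" y m] lt K
      by (simp add: is_hermite_cubic_def)
    show "hermite_spline K x y m (x K) = y K"
      using hermite_cubic[OF lt(2)] hermite_spline_piece[OF x, of "K - 1" "x K" y m] lt K
      by (simp add: is_hermite_cubic_def)
  qed
  have left: "mono_on {..x 1} ?f"
  proof (rule mono_onI)
    fix s t assume st: "s \<in> {..x 1}" "t \<in> {..x 1}" "s \<le> t"
    have f: "?f z = c * y 1 + c * m 1 * (z - x 1)" if "z \<le> x 1" for z
      using that ends by (cases "z = x 1") (auto simp: hermite_spline_def algebra_simps)
    show "?f s \<le> ?f t"
      using st slope[of 1] K by (simp add: f mult_left_mono)
  qed
  have right: "mono_on {x K..} ?f"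
  proof (rule mono_onI)
    fix s t assume st: "s \<in> {x K..}" "t \<in> {x K..}" "s \<le> t"
    have f: "?f z = c * y K + c * m K * (z - x K)" if "x K \<le> z" for z
      using that ends le by (cases "z = x K") (auto simp: hermite_spline_def algebra_simps)
    \<comment> \<open>\<open>m K\<close> is the right-end slope of the last piece, which has index
      \<open>K - 1\<close>.\<close>
    show "?f s \<le> ?f t"
      using st slope(2)[of "K - 1"] K by (simp add: f mult_left_mono)
  qed
  \<comment> \<open>Starting from the left tail, each induction step attaches one cubic
    piece.\<close>
  have "mono_on {..x k} ?f" if "1 \<le> k" "k \<le> K" for k
    using that
  proof (induction k rule: dec_induct)
    case base
    show ?case by (rule left)
  next
    case (step k)
    then have k: "k \<in> {1..K - 1}" by auto
    have "mono_on {x k..x (k + 1)} (\<lambda>t. c * poly (hermite_cubic (x k) (x (k + 1)) (y k) (y (k + 1)) (m k) (m (k + 1))) t)"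
      using less[OF k] y[OF k] fc[OF k] by (rule hermite_cubic_mono)
    then have "mono_on {x k..x (k + 1)} ?f"
      using k by (auto simp: mono_on_def hermite_spline_piece[OF x])
    with step have "mono_on ({..x k} \<union> {x k..x (k + 1)}) ?f"
      using less[OF k] by (intro mono_on_Un_linked[where b = "x k"]) auto
    also have "{..x k} \<union> {x k..x (k + 1)} = {..x (Suc k)}"
      using less[OF k] by auto
    finally show ?case .
  qed
  from this[of K] K have "mono_on ({..x K} \<union> {x K..}) ?f"
    using right by (intro mono_on_Un_linked[where b = "x K"]) auto
  moreover have "{..x K} \<union> {x K..} = UNIV" by auto
  ultimately show ?thesis by simp
qed

section \<open>Monotonicity through the layers of the network\<close>

text \<open>Translates the sign conditions of the theorem into \<open>fritsch_carlson\<close>;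
  \<open>c = 1\<close> is the increasing and \<open>c = -1\<close> the decreasing version.\<close>

lemma spline_mono:
  assumes wf: "kan_wf N" and c: "c \<noteq> 0"
    and lij: "l < depth N" "i \<in> {1..width N l}" "j \<in> {1..width N (l + 1)}"
    and cond: "\<And>k. k \<in> {1..num_knots N - 1} \<Longrightarrow>
      0 \<le> c * (val N l j i (k + 1) - val N l j i k) \<and>
      (secant N l j i k = 0 \<longrightarrow> slope N l j i k = 0 \<and> slope N l j i (k + 1) = 0) \<and>
      (0 < c * secant N l j i k \<longrightarrow> 0 \<le> c * slope N l j i k \<and> 0 \<le> c * slope N l j i (k + 1)) \<and>
      (0 < c * secant N l j i k \<longrightarrow> (alpha N l j i k)\<^sup>2 + (beta N l j i k)\<^sup>2 \<le> 9)"
  shows "mono (\<lambda>t. c * spline N l j i t)"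
  unfolding spline_def
proof (rule hermite_spline_mono)
  show "2 \<le> num_knots N" using wf by (simp add: kan_wf_def)
  show x: "strict_mono_on {1..num_knots N} (knot N l j i)" using wf lij by (auto simp: kan_wf_def)
  fix k assume k: "k \<in> {1..num_knots N - 1}"
  show y: "0 \<le> c * (val N l j i (k + 1) - val N l j i k)" using cond[OF k] by blast
  define d where "d = secant N l j i k"
  have "knot N l j i k < knot N l j i (k + 1)"
    using strict_mono_onD[OF x, of k "k + 1"] k by auto
  moreover have "c * d = c * (val N l j i (k + 1) - val N l j i k) / (knot N l j i (k + 1) - knot N l j i k)"
    by (simp add: d_def secant_def)
  ultimately have "0 \<le> c * d" using y by simp
  then have "d = 0 \<or> 0 < c * d" using c by (simp add: less_le)
  then have "fritsch_carlson d (slope N l j i k) (slope N l j i (k + 1))"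
  proof
    assume "d = 0"
    then show ?thesis using cond[OF k] by (auto simp: fritsch_carlson_def d_def)
  next
    assume cd: "0 < c * d"
    \<comment> \<open>The ratio equals \<open>(c * s) / (c * d)\<close>, so the sign
      \<open>c\<close> cancels.\<close>
    have "0 \<le> s / d" if "0 \<le> c * s" for s
      using divide_nonneg_pos[OF that cd] c by simp
    then show ?thesis
      using cond[OF k] cd unfolding fritsch_carlson_def alpha_def beta_def d_def[symmetric] by auto
  qed
  then show "fritsch_carlson ((val N l j i (k + 1) - val N l j i k) / (knot N l j i (k + 1) - knot N l j i k))
      (slope N l j i k) (slope N l j i (k + 1))"
    by (simp add: d_def secant_def)
qed

text \<open>Hidden layers preserve the coordinatewise order, being sums of nondecreasing functions
  with nonnegative weights. The induction starts at layer 1 because the input layer is controlled in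
  one coordinate only. For decreasing networks the two inputs are exchanged.\<close>

lemma layer_mono:
  assumes wf: "kan_wf N" and base: "mono (base N)" and l: "1 \<le> l" "l \<le> depth N"
    and nonneg: "\<And>l i j. \<lbrakk>l \<in> {1..depth N - 1}; i \<in> {1..width N l}; j \<in> {1..width N (l + 1)}\<rbrakk> \<Longrightarrow>
      0 \<le> spline_weight N l j i \<and> 0 \<le> base_weight N l j i"
    and mono: "\<And>l i j. \<lbrakk>l \<in> {1..depth N - 1}; i \<in> {1..width N l}; j \<in> {1..width N (l + 1)}\<rbrakk> \<Longrightarrow>
      mono (spline N l j i)"
    and first: "\<And>j. j \<in> {1..width N 1} \<Longrightarrow> layer N 1 x j \<le> layer N 1 x' j"
    and j: "j \<in> {1..width N l}"
  shows "layer N l x j \<le> layer N l x' j"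
  using l j
proof (induction l arbitrary: j rule: dec_induct)
  case base
  then show ?case using first by simp
next
  case (step l)
  then have l: "l \<in> {1..depth N - 1}" and j: "j \<in> {1..width N (l + 1)}" by auto
  have IH: "layer N l x i \<le> layer N l x' i" if "i \<in> {1..width N l}" for i
    using step that by simp
  show ?case
    unfolding layer.simps
    using nonneg[OF l _ j] IH monoD[OF mono[OF l _ j]] monoD[OF base]
    by (intro add_mono sum_mono mult_left_mono) auto
qed

text \<open>Only the summand of input \<open>r\<close> changes. The sign \<open>c\<close> sits on
  the spline itself but on the weight of the base function, since \<open>base N\<close> is
  increasing in both cases.\<close>

lemma input_layer_fun_upd_le:
  assumes r: "r \<in> {1..width N 0}" and t: "x r \<le> t"
    and spline: "mono (\<lambda>t. c * spline N 0 j r t)" and base: "mono (base N)"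
    and w: "0 \<le> spline_weight N 0 j r" "0 \<le> c * base_weight N 0 j r"
  shows "c * layer N 1 x j \<le> c * layer N 1 (x(r := t)) j"
proof -
  let ?g = "\<lambda>i s. spline_weight N 0 j i * spline N 0 j i s + base_weight N 0 j i * base N s"
  have "spline_weight N 0 j r * (c * spline N 0 j r (x r)) \<le> spline_weight N 0 j r * (c * spline N 0 j r t)"
    using w(1) monoD[OF spline t] by (rule mult_left_mono[rotated])
  moreover have "c * base_weight N 0 j r * base N (x r) \<le> c * base_weight N 0 j r * base N t"
    using w(2) monoD[OF base t] by (rule mult_left_mono[rotated])
  ultimately have "c * ?g r (x r) \<le> c * ?g r t"
    by (simp add: algebra_simps)
  then have "(\<Sum>i = 1..width N 0. c * ?g i (x i)) \<le> (\<Sum>i = 1..width N 0. c * ?g i ((x(r := t)) i))"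
    by (intro sum_mono) auto
  then show ?thesis
    by (simp add: sum_distrib_left distrib_left)
qed

theorem theorem3:
  fixes N :: kan and n r :: nat
  assumes "kan_wf N" and "width N 0 = n" and "width N (depth N) = 1"
    and "1 \<le> r" and "r \<le> n"
    and "mono (base N)"
    and hidden: "\<forall>l \<in> {1..depth N - 1}. \<forall>i \<in> {1..width N l}. \<forall>j \<in> {1..width N (l + 1)}.
        \<forall>k \<in> {1..num_knots N - 1}.
          spline_weight N l j i \<ge> 0 \<and> base_weight N l j i \<ge> 0 \<and>
          val N l j i (k + 1) \<ge> val N l j i k \<and>
          (secant N l j i k = 0 \<longrightarrow> slope N l j i k = 0 \<and> slope N l j i (k + 1) = 0) \<and>
          (secant N l j i k > 0 \<longrightarrow> slope N l j i k \<ge> 0 \<and> slope N l j i (k + 1) \<ge> 0) \<and>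
          (secant N l j i k > 0 \<longrightarrow> (alpha N l j i k)\<^sup>2 + (beta N l j i k)\<^sup>2 \<le> 9)"
  shows "((\<forall>j \<in> {1..width N 1}. \<forall>k \<in> {1..num_knots N - 1}.
            spline_weight N 0 j r \<ge> 0 \<and> base_weight N 0 j r \<ge> 0 \<and>
            val N 0 j r (k + 1) \<ge> val N 0 j r k \<and>
            (secant N 0 j r k = 0 \<longrightarrow> slope N 0 j r k = 0 \<and> slope N 0 j r (k + 1) = 0) \<and>
            (secant N 0 j r k > 0 \<longrightarrow> slope N 0 j r k \<ge> 0 \<and> slope N 0 j r (k + 1) \<ge> 0) \<and>
            (secant N 0 j r k > 0 \<longrightarrow> (alpha N 0 j r k)\<^sup>2 + (beta N 0 j r k)\<^sup>2 \<le> 9))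
          \<longrightarrow> partially_increasing n r (kan_fun N)) \<and>
         ((\<forall>j \<in> {1..width N 1}. \<forall>k \<in> {1..num_knots N - 1}.
            spline_weight N 0 j r \<ge> 0 \<and> base_weight N 0 j r \<le> 0 \<and>
            val N 0 j r (k + 1) \<le> val N 0 j r k \<and>
            (secant N 0 j r k = 0 \<longrightarrow> slope N 0 j r k = 0 \<and> slope N 0 j r (k + 1) = 0) \<and>
            (secant N 0 j r k < 0 \<longrightarrow> slope N 0 j r k \<le> 0 \<and> slope N 0 j r (k + 1) \<le> 0) \<and>
            (secant N 0 j r k < 0 \<longrightarrow> (alpha N 0 j r k)\<^sup>2 + (beta N 0 j r k)\<^sup>2 \<le> 9))
          \<longrightarrow> partially_decreasing n r (kan_fun N))"
proof -
  \<comment> \<open>The weight conditions are stated under the quantifier over \<open>k\<close>; the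
    index 1, available since there are at least two knots, extracts them.\<close>
  have r: "r \<in> {1..width N 0}" and depth: "1 \<le> depth N" and K: "1 \<in> {1..num_knots N - 1}"
    using assms(1,2,4,5) by (auto simp: kan_wf_def)
  have nonneg: "0 \<le> spline_weight N l j i \<and> 0 \<le> base_weight N l j i"
    if "l \<in> {1..depth N - 1}" "i \<in> {1..width N l}" "j \<in> {1..width N (l + 1)}" for l i j
    using hidden that K by blast
  have spline: "mono (spline N l j i)"
    if "l \<in> {1..depth N - 1}" "i \<in> {1..width N l}" "j \<in> {1..width N (l + 1)}" for l i j
    using spline_mono[OF assms(1), of 1 l i j] hidden that depth by auto
  have kan_fun_le: "kan_fun N x \<le> kan_fun N x'"
    if "\<And>j. j \<in> {1..width N 1} \<Longrightarrow> layer N 1 x j \<le> layer N 1 x' j" for x x'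
    unfolding kan_fun_def using nonneg spline that assms(3)
    by (intro layer_mono[OF assms(1) assms(6) depth order.refl]) auto
  show ?thesis
    unfolding partially_increasing_def partially_decreasing_def
  \<comment> \<open>Through \<open>kan_fun_le\<close> both claims reduce to comparing the nodes of
    layer 1, with the perturbed input on the smaller side in the decreasing case.\<close>
  proof (intro conjI impI ballI allI kan_fun_le, goal_cases)
    case (1 x t j)
    note cond = bspec[OF 1(1,4)]
    have w: "0 \<le> spline_weight N 0 j r" "0 \<le> 1 * base_weight N 0 j r"
      using bspec[OF cond K] by auto
    have "mono (\<lambda>s. 1 * spline N 0 j r s)"
    proof (rule spline_mono[OF assms(1)])
      fix k assume "k \<in> {1..num_knots N - 1}"
      from bspec[OF cond this] show
        "0 \<le> 1 * (val N 0 j r (k + 1) - val N 0 j r k) \<and>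
        (secant N 0 j r k = 0 \<longrightarrow> slope N 0 j r k = 0 \<and> slope N 0 j r (k + 1) = 0) \<and>
        (0 < 1 * secant N 0 j r k \<longrightarrow> 0 \<le> 1 * slope N 0 j r k \<and> 0 \<le> 1 * slope N 0 j r (k + 1)) \<and>
        (0 < 1 * secant N 0 j r k \<longrightarrow> (alpha N 0 j r k)\<^sup>2 + (beta N 0 j r k)\<^sup>2 \<le> 9)"
        by simp
    qed (use r depth 1(4) in auto)
    from input_layer_fun_upd_le[where x = x and t = t, OF r 1(3) this assms(6) w] show ?case
      by (simp del: layer.simps One_nat_def)
  next
    case (2 x t j)
    note cond = bspec[OF 2(1,4)]
    have w: "0 \<le> spline_weight N 0 j r" "0 \<le> - 1 * base_weight N 0 j r"
      using bspec[OF cond K] by auto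
    \<comment> \<open>Decreasing splines enter with \<open>c = -1\<close>; the final simplification
      turns the negated comparison around.\<close>
    have "mono (\<lambda>s. - 1 * spline N 0 j r s)"
    proof (rule spline_mono[OF assms(1)])
      fix k assume "k \<in> {1..num_knots N - 1}"
      from bspec[OF cond this] show
        "0 \<le> - 1 * (val N 0 j r (k + 1) - val N 0 j r k) \<and>
        (secant N 0 j r k = 0 \<longrightarrow> slope N 0 j r k = 0 \<and> slope N 0 j r (k + 1) = 0) \<and>
        (0 < - 1 * secant N 0 j r k \<longrightarrow> 0 \<le> - 1 * slope N 0 j r k \<and> 0 \<le> - 1 * slope N 0 j r (k + 1)) \<and>
        (0 < - 1 * secant N 0 j r k \<longrightarrow> (alpha N 0 j r k)\<^sup>2 + (beta N 0 j r k)\<^sup>2 \<le> 9)"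
        by simp
    qed (use r depth 2(4) in auto)
    from input_layer_fun_upd_le[where x = x and t = t, OF r 2(3) this assms(6) w] show ?case
      by (simp del: layer.simps One_nat_def)
  qed
qed

end
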